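(* Let $(X,\mu)$ be a measure space with $\mu$ a non-trivial, $\sigma$-finite, positive measure, let $\mathcal{H}$ be a separable Hilbert space, and let $\Psi:X\to\mathcal{H}$ be a continuous frame or, more generally, a lower semi-frame. If $\Psi$ has finite redundancy, $R(\Psi)<\infty$, then the measure space $(X,\mu)$ is atomic.
   Context: A measurable set $A\subset X$ is an atom if $\mu(A)>0$ and every measurable $B\subset A$ with $\mu(B)<\mu(A)$ satisfies $\mu(B)=0$. $(X,\mu)$ is atomic if there is a countable partition $\{A_n\}_{n\in\mathbb{N}}$ of $X$ consisting of atoms and null sets. A map $\Psi:X\to\mathcal{H}$, $x\mapsto\Psi_x$, is weakly measurable if $x\mapsto\langle f,\Psi_x\rangle$ is measurable for every $f\in\mathcal{H}$. A weakly measurable $\Psi$ is a lower semi-frame if there is $m>0$ with $m\|f\|^2\le\int_X|\langle f,\Psi_x\rangle|^2d\mu(x)$ for all $f\in\mathcal{H}$ (the integral may be $+\infty$); it is a continuous frame if in addition there is $M>0$ with $\int_X|\langle f,\Psi_x\rangle|^2d\mu(x)\le M\|f\|^2$ for all $f\in\mathcal{H}$. The analysis operator is $C_\Psi f(x):=\langle f,\Psi_x\rangle$, as an operator into $L^2(X,\mu)$ with domain $\{f\in\mathcal{H}:\langle f,\Psi_\cdot\rangle\in L^2(X,\mu)\}$ (all of $\mathcal{H}$ for a frame). The redundancy of $\Psi$ is $R(\Psi):=\dim\big((\operatorname{Ran}C_\Psi)^\perp\big)$, the orthogonal complement being taken in $L^2(X,\mu)$. *)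

theory Defs
  imports "HOL-Analysis.Analysis"
begin

text \<open>
  Scalars are real or complex.  A \<^class>\<open>real_normed_field\<close> has a multiplicative norm, so by
  Gelfand--Mazur it is isomorphic to the reals or to the complex numbers, and the last axiom then
  forces \<open>conj\<close> to be the usual conjugation.
\<close>

class conj_field = real_normed_field + banach + second_countable_topology +
  fixes conj :: "'a \<Rightarrow> 'a"
  assumes conj_add: "conj (x + y) = conj x + conj y"
    and conj_mult: "conj (x * y) = conj x * conj y"
    and conj_conj: "conj (conj x) = x"
    and mult_conj: "x * conj x = (norm x)\<^sup>2 *\<^sub>R 1"

instantiation real :: conj_field
begin
definition conj_real :: "real \<Rightarrow> real" where "conj_real x = x"
instance by standard (simp_all add: conj_real_def power2_eq_square)
end

instantiation complex :: conj_field
begin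
definition conj_complex :: "complex \<Rightarrow> complex" where "conj_complex = cnj"
instance by standard (simp_all add: conj_complex_def scaleR_conv_of_real flip: complex_norm_square)
end

text \<open>
  Completeness is part of \<^class>\<open>banach\<close>; the inner product \<open>ip\<close> is linear in its first argument
  and induces the norm of the type.
\<close>

locale hilbert_space =
  fixes scale :: "'k::conj_field \<Rightarrow> 'h::banach \<Rightarrow> 'h"
    and ip :: "'h \<Rightarrow> 'h \<Rightarrow> 'k"
  assumes vector_space_scale: "vector_space scale"
    and scale_of_real: "scale (of_real r) x = r *\<^sub>R x"
    and ip_add_left: "ip (x + y) z = ip x z + ip y z"
    and ip_scale_left: "ip (scale a x) y = a * ip x y"
    and ip_conj_sym: "ip x y = conj (ip y x)"
    and ip_self: "ip x x = of_real ((norm x)\<^sup>2)"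

lemma hilbert_space_real_inner:
  "hilbert_space (*\<^sub>R) (inner :: 'h::{real_inner, banach} \<Rightarrow> 'h \<Rightarrow> real)"
proof
qed (simp_all add: scaleR_right_distrib scaleR_left_distrib inner_add_left conj_real_def
      power2_norm_eq_inner, rule inner_commute)

lemma hilbert_space_complex:
  "hilbert_space (*) (\<lambda>x y :: complex. x * cnj y)"
proof
qed (simp_all add: algebra_simps conj_complex_def scaleR_conv_of_real flip: complex_norm_square)

text \<open>
  Elements of $L^2(M)$ are represented by square-integrable functions, equality being equality
  almost everywhere.  Accordingly, linear independence in $L^2(M)$ is linear independence modulo
  null functions, and \<open>L2_dim M S\<close> is the dimension of the image of \<open>S\<close> in $L^2(M)$, for \<open>S\<close> a
  linear subspace; it is \<open>\<infinity>\<close> for every infinite dimension.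
\<close>

definition L2 :: "'x measure \<Rightarrow> ('x \<Rightarrow> 'k::conj_field) set" where
  "L2 M = {F \<in> borel_measurable M. integrable M (\<lambda>x. (norm (F x))\<^sup>2)}"

definition L2_inner :: "'x measure \<Rightarrow> ('x \<Rightarrow> 'k::conj_field) \<Rightarrow> ('x \<Rightarrow> 'k) \<Rightarrow> 'k" where
  "L2_inner M F G = (LINT x|M. F x * conj (G x))"

definition L2_orthogonal_complement ::
    "'x measure \<Rightarrow> ('x \<Rightarrow> 'k::conj_field) set \<Rightarrow> ('x \<Rightarrow> 'k) set" where
  "L2_orthogonal_complement M S = {F \<in> L2 M. \<forall>G\<in>S. L2_inner M F G = 0}"

definition L2_independent :: "'x measure \<Rightarrow> nat \<Rightarrow> (nat \<Rightarrow> 'x \<Rightarrow> 'k::conj_field) \<Rightarrow> bool" where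
  "L2_independent M n F \<longleftrightarrow>
    (\<forall>c. (AE x in M. (\<Sum>i<n. c i * F i x) = 0) \<longrightarrow> (\<forall>i<n. c i = 0))"

definition L2_dim :: "'x measure \<Rightarrow> ('x \<Rightarrow> 'k::conj_field) set \<Rightarrow> enat" where
  "L2_dim M S = Sup {enat n | n. \<exists>F. (\<forall>i<n. F i \<in> S) \<and> L2_independent M n F}"

definition atom :: "'x measure \<Rightarrow> 'x set \<Rightarrow> bool" where
  "atom M A \<longleftrightarrow> A \<in> sets M \<and> emeasure M A > 0 \<and>
    (\<forall>B\<in>sets M. B \<subseteq> A \<and> emeasure M B < emeasure M A \<longrightarrow> emeasure M B = 0)"

definition atomic :: "'x measure \<Rightarrow> bool" where
  "atomic M \<longleftrightarrow> (\<exists>A :: nat \<Rightarrow> 'x set. disjoint_family A \<and> (\<Union>n. A n) = space M \<and>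
    (\<forall>n. atom M (A n) \<or> A n \<in> null_sets M))"

context hilbert_space
begin

definition weakly_measurable :: "'x measure \<Rightarrow> ('x \<Rightarrow> 'h) \<Rightarrow> bool" where
  "weakly_measurable M \<Psi> \<longleftrightarrow> (\<forall>f. (\<lambda>x. ip f (\<Psi> x)) \<in> borel_measurable M)"

definition lower_semi_frame :: "'x measure \<Rightarrow> ('x \<Rightarrow> 'h) \<Rightarrow> bool" where
  "lower_semi_frame M \<Psi> \<longleftrightarrow> weakly_measurable M \<Psi> \<and>
    (\<exists>m>0. \<forall>f. ennreal (m * (norm f)\<^sup>2) \<le> (\<integral>\<^sup>+ x. ennreal ((norm (ip f (\<Psi> x)))\<^sup>2) \<partial>M))"

definition continuous_frame :: "'x measure \<Rightarrow> ('x \<Rightarrow> 'h) \<Rightarrow> bool" where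
  "continuous_frame M \<Psi> \<longleftrightarrow> lower_semi_frame M \<Psi> \<and>
    (\<exists>C>0. \<forall>f. (\<integral>\<^sup>+ x. ennreal ((norm (ip f (\<Psi> x)))\<^sup>2) \<partial>M) \<le> ennreal (C * (norm f)\<^sup>2))"

definition analysis :: "('x \<Rightarrow> 'h) \<Rightarrow> 'h \<Rightarrow> 'x \<Rightarrow> 'k" where
  "analysis \<Psi> f = (\<lambda>x. ip f (\<Psi> x))"

definition analysis_domain :: "'x measure \<Rightarrow> ('x \<Rightarrow> 'h) \<Rightarrow> 'h set" where
  "analysis_domain M \<Psi> = {f. analysis \<Psi> f \<in> L2 M}"

definition analysis_range :: "'x measure \<Rightarrow> ('x \<Rightarrow> 'h) \<Rightarrow> ('x \<Rightarrow> 'k) set" where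
  "analysis_range M \<Psi> = analysis \<Psi> ` analysis_domain M \<Psi>"

definition redundancy :: "'x measure \<Rightarrow> ('x \<Rightarrow> 'h) \<Rightarrow> enat" where
  "redundancy M \<Psi> = L2_dim M (L2_orthogonal_complement M (analysis_range M \<Psi>))"

end

end

theory Submission
  imports Defs
begin

text \<open>
  Where \<open>norm (\<Psi> x) \<le> K\<close>, the lower frame bound makes evaluation at \<open>x\<close> bounded on the range of
  the analysis operator, uniformly in \<open>x\<close>, and the range has finite codimension.  On a non-atomic
  part of such a region one could choose arbitrarily many disjoint sets of arbitrarily small
  positive measure; some nontrivial combination of their indicators lies in the range, and it has
  small $L^2$ norm compared with its values.  So a set of finite measure in such a region admits
  only boundedly many disjoint subsets of positive measure, hence splits into finitely many atoms
  and a null set; countably many of these sets cover the space.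
\<close>

section \<open>Scalars\<close>

text \<open>By commutativity and the involution law, \<open>x * conj x\<close> is also the product
  that \<open>mult_conj\<close> evaluates at \<open>conj x\<close>, so the two squared norms
  coincide.\<close>

lemma norm_conj [simp]: "norm (conj x) = norm (x :: 'a::conj_field)"
proof -
  have "(norm x)\<^sup>2 *\<^sub>R (1::'a) = (norm (conj x))\<^sup>2 *\<^sub>R 1"
    using mult_conj[of x] mult_conj[of "conj x"] by (simp add: conj_conj mult.commute)
  then show ?thesis
    by simp
qed

text \<open>A nonzero real cancels from its product with its conjugate, which
  \<open>mult_conj\<close> identifies as its square; zero is settled through the norm.\<close>

lemma conj_of_real [simp]: "conj (of_real r :: 'a::conj_field) = of_real r"
proof (cases "r = 0")
  case True
  have "norm (conj (0::'a)) = 0"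
    by (simp only: norm_conj norm_zero)
  then show ?thesis
    by (simp only: True of_real_0 norm_eq_zero)
next
  case False
  have "(of_real r :: 'a) * conj (of_real r) = of_real r * of_real r"
    by (simp add: mult_conj power2_eq_square scaleR_conv_of_real flip: of_real_mult)
  then show ?thesis
    using False by simp
qed

text \<open>Real linearity and continuity let \<open>conj\<close> pass under the integral sign and
  make it Borel measurable.\<close>

lemma bounded_linear_conj: "bounded_linear (conj :: 'a::conj_field \<Rightarrow> 'a)"
proof
  show "conj (x + y) = conj x + conj y" for x y :: 'a
    by (rule conj_add)
  show "conj (r *\<^sub>R x) = r *\<^sub>R conj x" for r and x :: 'a
    by (simp add: scaleR_conv_of_real conj_mult)
  show "\<exists>K. \<forall>x::'a. norm (conj x) \<le> norm x * K"
    by (rule exI[of _ 1]) simp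
qed

lemma conj_diff: "conj (x - y) = conj x - conj (y :: 'a::conj_field)"
  by (rule linear_diff[OF bounded_linear.linear[OF bounded_linear_conj]])

lemma borel_measurable_conj [measurable]: "(conj :: 'a::conj_field \<Rightarrow> 'a) \<in> borel_measurable borel"
  by (intro borel_measurable_continuous_onI linear_continuous_on bounded_linear_conj)

lemma of_real_norm_sq: "of_real ((norm x)\<^sup>2) = x * conj (x :: 'a::conj_field)"
  by (simp add: mult_conj scaleR_conv_of_real)

text \<open>In the field every squared norm is a product \<open>x * conj x\<close>, which turns the
  identity into algebra; it descends to the reals because \<open>of_real\<close> is
  injective.\<close>

lemma parallelogram_conj_field:
  "(norm (a + b))\<^sup>2 + (norm (a - b))\<^sup>2 = 2 * (norm a)\<^sup>2 + 2 * (norm (b :: 'a::conj_field))\<^sup>2"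
proof -
  have "(of_real ((norm (a + b))\<^sup>2 + (norm (a - b))\<^sup>2) :: 'a)
      = of_real (2 * (norm a)\<^sup>2 + 2 * (norm b)\<^sup>2)"
    unfolding of_real_add of_real_mult of_real_norm_sq
    by (simp add: conj_add conj_diff algebra_simps)
  then show ?thesis
    by (simp only: of_real_eq_iff)
qed

text \<open>The discriminant argument behind Cauchy-Schwarz: there \<open>a\<close> and
  \<open>b\<close> are the squared norms of two vectors, \<open>z\<close> is their inner product and
  \<open>r\<close> the squared norm of the first minus \<open>t\<close> times the second. It is
  isolated because, with \<open>a = 0\<close>, it also serves the variational argument in
  $L^2$.\<close>

lemma norm_sq_le_of_quadratic:
  fixes z :: "'a::conj_field"
  assumes "b \<ge> 0"
    and *: "\<And>t. \<exists>r\<ge>0. of_real r = of_real a - (conj t * z + conj (conj t * z)) + of_real ((norm t)\<^sup>2 * b)"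
  shows "(norm z)\<^sup>2 \<le> a * b"
proof -
  \<comment> \<open>With \<open>t\<close> a real multiple \<open>s * z\<close>, the cross terms
    become real and the hypothesis a real quadratic in \<open>s\<close>.\<close>
  have q: "0 \<le> a - 2 * s * (norm z)\<^sup>2 + s\<^sup>2 * (norm z)\<^sup>2 * b" for s
  proof -
    obtain r where r: "r \<ge> 0" "(of_real r :: 'a) = of_real a
        - (conj (of_real s * z) * z + conj (conj (of_real s * z) * z)) + of_real ((norm (of_real s * z))\<^sup>2 * b)"
      using * by blast
    have 1: "conj (of_real s * z) * z = of_real (s * (norm z)\<^sup>2)"
      unfolding of_real_mult of_real_norm_sq by (simp add: conj_mult)
    have "(of_real r :: 'a) = of_real (a - 2 * s * (norm z)\<^sup>2 + s\<^sup>2 * (norm z)\<^sup>2 * b)"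
      unfolding r(2) 1 conj_of_real
      by (simp add: norm_mult power_mult_distrib)
    then show ?thesis
      using r(1) by (simp only: of_real_eq_iff)
  qed
  show ?thesis
  proof (cases "b = 0")
    case True
    have "(norm z)\<^sup>2 = 0"
    proof (rule ccontr)
      assume "(norm z)\<^sup>2 \<noteq> 0"
      \<comment> \<open>For \<open>b = 0\<close> the quadratic is affine in \<open>s\<close> and
        falls without bound; the \<open>s\<close> substituted here already makes it
        negative.\<close>
      then have "0 \<le> a - (\<bar>a\<bar> + 1)"
        using q[of "(\<bar>a\<bar> + 1) / (2 * (norm z)\<^sup>2)"] True by simp
      then show False
        by linarith
    qed
    then show ?thesis
      using True by simp
  next
    case False
    \<comment> \<open>The choice \<open>s = 1 / b\<close> minimises the quadratic.\<close>
    then have "0 \<le> a - (norm z)\<^sup>2 / b"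
      using q[of "1 / b"] by (simp add: power2_eq_square)
    then show ?thesis
      using False assms(1) by (simp add: field_simps)
  qed
qed

section \<open>Square-integrable functions\<close>

lemma L2_measurable [measurable_dest]: "F \<in> L2 M \<Longrightarrow> F \<in> borel_measurable M"
  by (simp add: L2_def)

lemma L2_integrable: "F \<in> L2 M \<Longrightarrow> integrable M (\<lambda>x. (norm (F x))\<^sup>2)"
  by (simp add: L2_def)

section \<open>Square-integrable functions form a vector space\<close>

lemma norm_add_sq_le: "(norm (a + b))\<^sup>2 \<le> 2 * (norm a)\<^sup>2 + 2 * (norm (b :: 'a::real_normed_vector))\<^sup>2"
proof -
  have "(norm (a + b))\<^sup>2 \<le> (norm a + norm b)\<^sup>2"
    by (intro power_mono norm_triangle_ineq) simp
  also have "\<dots> \<le> 2 * (norm a)\<^sup>2 + 2 * (norm b)\<^sup>2"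
    using zero_le_power2[of "norm a - norm b"] by (simp add: power2_eq_square algebra_simps)
  finally show ?thesis .
qed

lemma L2_add:
  assumes [measurable]: "F \<in> L2 M" "G \<in> L2 M"
  shows "(\<lambda>x. F x + G x) \<in> L2 M"
proof -
  have "integrable M (\<lambda>x. (norm (F x + G x))\<^sup>2)"
    by (rule Bochner_Integration.integrable_bound[of _ "\<lambda>x. 2 * (norm (F x))\<^sup>2 + 2 * (norm (G x))\<^sup>2"])
      (use assms[THEN L2_integrable] norm_add_sq_le in auto)
  then show ?thesis
    by (simp add: L2_def)
qed

lemma L2_cmult:
  assumes [measurable]: "F \<in> L2 M"
  shows "(\<lambda>x. c * F x) \<in> L2 M"
  using L2_integrable[OF assms] by (simp add: L2_def norm_mult power_mult_distrib)

lemma L2_diff: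
  assumes "F \<in> L2 M" "G \<in> L2 M"
  shows "(\<lambda>x. F x - G x) \<in> L2 M"
  using L2_add[OF assms(1) L2_cmult[OF assms(2), of "-1"]] by simp

lemma L2_zero: "(\<lambda>x. 0) \<in> L2 M"
  by (simp add: L2_def)

lemma L2_indicator:
  assumes [measurable]: "A \<in> sets M" and "emeasure M A < \<infinity>"
  shows "(indicator A :: _ \<Rightarrow> 'k::conj_field) \<in> L2 M"
proof -
  have "(\<lambda>x. (norm (indicator A x :: 'k))\<^sup>2) = indicator A"
    by (auto simp: fun_eq_iff indicator_def)
  then show ?thesis
    using assms by (simp add: L2_def)
qed

section \<open>Inner product and orthogonality in $L^2$\<close>

lemma L2_inner_integrable:
  assumes [measurable]: "F \<in> L2 M" "G \<in> L2 M"
  shows "integrable M (\<lambda>x. F x * conj (G x))"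
proof (rule Bochner_Integration.integrable_bound)
  show "integrable M (\<lambda>x. (norm (F x))\<^sup>2 + (norm (G x))\<^sup>2)"
    using assms[THEN L2_integrable] by simp
  have "norm (F x) * norm (G x) \<le> (norm (F x))\<^sup>2 + (norm (G x))\<^sup>2" for x
    using zero_le_power2[of "norm (F x) - norm (G x)"] zero_le_power2[of "norm (F x)"]
      zero_le_power2[of "norm (G x)"]
    by (simp add: power2_diff; linarith)
  then show "AE x in M. norm (F x * conj (G x)) \<le> norm ((norm (F x))\<^sup>2 + (norm (G x))\<^sup>2)"
    by (auto simp: norm_mult)
qed measurable

text \<open>Pointwise expansion of the squared norm, integrated term by term. The identity is stated
  in the scalar field, where the cross terms live, so as to match the hypothesis of
  \<open>norm_sq_le_of_quadratic\<close>.\<close>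

lemma L2_norm_diff_cmult:
  fixes F G :: "'x \<Rightarrow> 'k::conj_field"
  assumes F: "F \<in> L2 M" and G: "G \<in> L2 M"
  shows "(of_real (LINT x|M. (norm (F x - t * G x))\<^sup>2) :: 'k)
    = of_real (LINT x|M. (norm (F x))\<^sup>2) - (conj t * L2_inner M F G + conj (conj t * L2_inner M F G))
      + of_real ((norm t)\<^sup>2 * (LINT x|M. (norm (G x))\<^sup>2))"
proof -
  note [measurable] = F G
  note i = L2_inner_integrable[OF F G]
  note FI = L2_integrable[OF F] and GI = L2_integrable[OF G]
  have pt: "of_real ((norm (F x - t * G x))\<^sup>2) = of_real ((norm (F x))\<^sup>2)
      - (conj t * (F x * conj (G x)) + conj (conj t * (F x * conj (G x))))
      + of_real ((norm t)\<^sup>2 * (norm (G x))\<^sup>2)" for x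
    unfolding of_real_mult of_real_norm_sq
    by (simp add: conj_diff conj_mult conj_conj algebra_simps)
  have j: "integrable M (\<lambda>x. conj t * (F x * conj (G x)))"
    using i by simp
  have k: "integrable M (\<lambda>x. conj (conj t * (F x * conj (G x))))"
    by (rule integrable_bounded_linear[OF bounded_linear_conj j])
  have o: "integrable M (\<lambda>x. of_real (h x) :: 'k)" if "integrable M h" for h :: "_ \<Rightarrow> real"
    using integrable_bounded_linear[OF bounded_linear_of_real that] .
  have o': "(LINT x|M. of_real (h x) :: 'k) = of_real (LINT x|M. h x)" if "integrable M h" for h :: "_ \<Rightarrow> real"
    using integral_bounded_linear[OF bounded_linear_of_real that] .
  have "(of_real (LINT x|M. (norm (F x - t * G x))\<^sup>2) :: 'k)
      = (LINT x|M. of_real ((norm (F x - t * G x))\<^sup>2))"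
    by (rule o'[symmetric]) (rule L2_integrable[OF L2_diff[OF F L2_cmult[OF G]]])
  also have "\<dots> = (LINT x|M. of_real ((norm (F x))\<^sup>2))
      - ((LINT x|M. conj t * (F x * conj (G x))) + (LINT x|M. conj (conj t * (F x * conj (G x)))))
      + (LINT x|M. of_real ((norm t)\<^sup>2 * (norm (G x))\<^sup>2))"
    unfolding pt
    by (subst Bochner_Integration.integral_add Bochner_Integration.integral_diff
        | intro Bochner_Integration.integrable_add Bochner_Integration.integrable_diff j k o FI GI
          integrable_mult_right refl)+
  also have "(LINT x|M. conj (conj t * (F x * conj (G x)))) = conj (LINT x|M. conj t * (F x * conj (G x)))"
    by (rule integral_bounded_linear[OF bounded_linear_conj j])
  also have "(LINT x|M. conj t * (F x * conj (G x))) = conj t * L2_inner M F G"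
    by (simp add: L2_inner_def)
  finally show ?thesis
    using FI GI by (simp only: o' integrable_mult_right integral_mult_right_zero)
qed

text \<open>The first-order condition for a minimum: subtracting the value at \<open>t = 0\<close>
  leaves a nonnegative quadratic without constant term, so \<open>norm_sq_le_of_quadratic\<close>
  applies with \<open>a = 0\<close>.\<close>

lemma L2_orthogonal_if_minimal:
  fixes F G :: "'x \<Rightarrow> 'k::conj_field"
  assumes "F \<in> L2 M" "G \<in> L2 M"
    and min: "\<And>t. (LINT x|M. (norm (F x))\<^sup>2) \<le> (LINT x|M. (norm (F x - t * G x))\<^sup>2)"
  shows "L2_inner M F G = 0"
proof -
  have "(norm (L2_inner M F G))\<^sup>2 \<le> 0 * (LINT x|M. (norm (G x))\<^sup>2)"
  proof (rule norm_sq_le_of_quadratic)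
    fix t
    let ?r = "(LINT x|M. (norm (F x - t * G x))\<^sup>2) - (LINT x|M. (norm (F x))\<^sup>2)"
    have "?r \<ge> 0"
      using min[of t] by simp
    moreover have "of_real ?r = of_real 0 - (conj t * L2_inner M F G + conj (conj t * L2_inner M F G))
        + of_real ((norm t)\<^sup>2 * (LINT x|M. (norm (G x))\<^sup>2))"
      unfolding of_real_diff L2_norm_diff_cmult[OF assms(1,2)] by simp
    ultimately show "\<exists>r\<ge>0. of_real r = of_real 0 - (conj t * L2_inner M F G + conj (conj t * L2_inner M F G))
        + of_real ((norm t)\<^sup>2 * (LINT x|M. (norm (G x))\<^sup>2))"
      by blast
  qed simp
  then show ?thesis
    by simp
qed

text \<open>\<open>L2_dim\<close> is a supremum; if independent families of every length existed,
  every \<open>enat n\<close> would lie below it.\<close>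

lemma L2_dim_finite_bound:
  assumes "L2_dim M S < \<infinity>"
  obtains n where "\<And>F. \<forall>i<n. F i \<in> S \<Longrightarrow> \<not> L2_independent M n F"
proof (rule ccontr)
  assume "\<not> thesis"
  then have "\<exists>F. (\<forall>i<n. F i \<in> S) \<and> L2_independent M n F" for n
    using that by blast
  then have le: "enat n \<le> L2_dim M S" for n
    unfolding L2_dim_def by (intro Sup_upper) auto
  obtain k where "L2_dim M S = enat k"
    using assms by (cases "L2_dim M S") auto
  then show False
    using le[of "Suc k"] by simp
qed

section \<open>The analysis operator\<close>

context hilbert_space
begin

section \<open>Sesquilinearity and the Cauchy-Schwarz inequality\<close>

lemma ip_diff_left: "ip (x - y) z = ip x z - ip y z"
  using ip_add_left[of "x - y" y z] by simp

lemma ip_zero_left [simp]: "ip 0 z = 0"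
  using ip_diff_left[of 0 0 z] by simp

lemma ip_diff_right: "ip x (y - z) = ip x y - ip x z"
  unfolding ip_conj_sym[of x] by (simp add: ip_diff_left conj_diff)

lemma ip_scale_right: "ip x (scale a y) = conj a * ip x y"
  unfolding ip_conj_sym[of x] by (simp add: ip_scale_left conj_mult)

lemma ip_sum_scale_left: "ip (\<Sum>i\<in>I. scale (c i) (f i)) y = (\<Sum>i\<in>I. c i * ip (f i) y)"
  by (induction I rule: infinite_finite_induct) (simp_all add: ip_add_left ip_scale_left)

lemma cauchy_schwarz: "norm (ip x y) \<le> norm x * norm y"
proof -
  have "(norm (ip x y))\<^sup>2 \<le> (norm x)\<^sup>2 * (norm y)\<^sup>2"
  proof (rule norm_sq_le_of_quadratic)
    fix t
    have "of_real ((norm (x - scale t y))\<^sup>2) = of_real ((norm x)\<^sup>2)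
        - (conj t * ip x y + conj (conj t * ip x y)) + of_real ((norm t)\<^sup>2 * (norm y)\<^sup>2)"
      unfolding of_real_mult of_real_norm_sq ip_self[symmetric]
      using ip_conj_sym[of y x]
      by (simp add: ip_diff_left ip_diff_right ip_scale_left ip_scale_right conj_mult conj_conj algebra_simps)
    then show "\<exists>r\<ge>0. of_real r = of_real ((norm x)\<^sup>2)
        - (conj t * ip x y + conj (conj t * ip x y)) + of_real ((norm t)\<^sup>2 * (norm y)\<^sup>2)"
      by (intro exI[of _ "(norm (x - scale t y))\<^sup>2"]) simp
  qed simp
  then show ?thesis
    unfolding power_mult_distrib[symmetric] by (rule power2_le_imp_le) simp
qed

lemma bounded_linear_ip_left: "bounded_linear (\<lambda>x. ip x y)"
proof
  show "\<exists>K. \<forall>x. norm (ip x y) \<le> norm x * K"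
    using cauchy_schwarz by (intro exI[of _ "norm y"]) simp
  show "ip (r *\<^sub>R x) y = r *\<^sub>R ip x y" for r x
    by (simp add: ip_scale_left scaleR_conv_of_real flip: scale_of_real)
qed (rule ip_add_left)

section \<open>Linearity of the analysis operator and of its domain\<close>

lemma analysis_diff: "analysis \<Psi> (f - g) x = analysis \<Psi> f x - analysis \<Psi> g x"
  by (simp add: analysis_def ip_diff_left)

lemma analysis_add: "analysis \<Psi> (f + g) x = analysis \<Psi> f x + analysis \<Psi> g x"
  by (simp add: analysis_def ip_add_left)

lemma analysis_scale: "analysis \<Psi> (scale c f) x = c * analysis \<Psi> f x"
  by (simp add: analysis_def ip_scale_left)

lemma analysis_scaleR: "analysis \<Psi> (r *\<^sub>R f) x = of_real r * analysis \<Psi> f x"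
  by (simp add: analysis_scale flip: scale_of_real)

lemma analysis_domain_zero: "0 \<in> analysis_domain M \<Psi>"
  by (simp add: analysis_domain_def analysis_def L2_zero)

lemma analysis_domain_add:
  "f \<in> analysis_domain M \<Psi> \<Longrightarrow> g \<in> analysis_domain M \<Psi> \<Longrightarrow> f + g \<in> analysis_domain M \<Psi>"
  using L2_add[of "analysis \<Psi> f" M "analysis \<Psi> g"] by (simp add: analysis_domain_def flip: analysis_add)

lemma analysis_domain_scale:
  "f \<in> analysis_domain M \<Psi> \<Longrightarrow> scale c f \<in> analysis_domain M \<Psi>"
  using L2_cmult[of "analysis \<Psi> f" M c] by (simp add: analysis_domain_def flip: analysis_scale)

lemma analysis_domain_scaleR:
  "f \<in> analysis_domain M \<Psi> \<Longrightarrow> r *\<^sub>R f \<in> analysis_domain M \<Psi>"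
  using analysis_domain_scale[of f M \<Psi> "of_real r"] by (simp add: scale_of_real)

lemma analysis_domain_diff:
  "f \<in> analysis_domain M \<Psi> \<Longrightarrow> g \<in> analysis_domain M \<Psi> \<Longrightarrow> f - g \<in> analysis_domain M \<Psi>"
  using L2_diff[of "analysis \<Psi> f" M "analysis \<Psi> g"] by (simp add: analysis_domain_def flip: analysis_diff)

lemma analysis_L2: "f \<in> analysis_domain M \<Psi> \<Longrightarrow> analysis \<Psi> f \<in> L2 M"
  by (simp add: analysis_domain_def)

text \<open>
  A minimising sequence for the distance from \<open>F\<close> to the range converges in the Hilbert space,
  by the lower bound; evaluation at each point being continuous, Fatou's lemma shows that the
  limit attains the distance.  Completeness of $L^2$ is not needed.
\<close>

lemma exists_projection_onto_analysis_range:
  assumes frame: "lower_semi_frame M \<Psi>" and F: "F \<in> L2 M"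
  obtains f where "f \<in> analysis_domain M \<Psi>"
    "(\<lambda>x. F x - analysis \<Psi> f x) \<in> L2_orthogonal_complement M (analysis_range M \<Psi>)"
proof -
  let ?D = "analysis_domain M \<Psi>"
  note [measurable] = F
  obtain m where m: "m > 0"
    "\<And>f. ennreal (m * (norm f)\<^sup>2) \<le> (\<integral>\<^sup>+ x. ennreal ((norm (ip f (\<Psi> x)))\<^sup>2) \<partial>M)"
    using frame unfolding lower_semi_frame_def by blast
  have [measurable]: "analysis \<Psi> f \<in> borel_measurable M" for f
    using frame by (simp add: lower_semi_frame_def weakly_measurable_def analysis_def)
  define d where "d f = (LINT x|M. (norm (F x - analysis \<Psi> f x))\<^sup>2)" for f
  have int: "integrable M (\<lambda>x. (norm (F x - analysis \<Psi> f x))\<^sup>2)" if "f \<in> ?D" for f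
    using L2_integrable[OF L2_diff[OF F analysis_L2[OF that]]] .
  have lower: "m * (norm f)\<^sup>2 \<le> (LINT x|M. (norm (analysis \<Psi> f x))\<^sup>2)" if "f \<in> ?D" for f
  proof -
    have "ennreal (m * (norm f)\<^sup>2) \<le> ennreal (LINT x|M. (norm (analysis \<Psi> f x))\<^sup>2)"
      using m(2)[of f] nn_integral_eq_integral[OF L2_integrable[OF analysis_L2[OF that]]]
      by (simp add: analysis_def)
    then show ?thesis
      by (simp add: ennreal_le_iff)
  qed
  define \<delta> where "\<delta> = (INF f\<in>?D. d f)"
  have bdd: "bdd_below (d ` ?D)"
    by (rule bdd_belowI[of _ 0]) (auto simp: d_def)
  have \<delta>_le: "\<delta> \<le> d f" if "f \<in> ?D" for f
    unfolding \<delta>_def by (rule cINF_lower[OF bdd that])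
  \<comment> \<open>Parallelogram identity around the midpoint \<open>h\<close>, whose squared
    distance is at least \<open>\<delta>\<close>; the lower frame bound converts closeness in $L^2$
    into closeness in the Hilbert space.\<close>
  have dist: "m * (norm (f - g))\<^sup>2 \<le> 2 * d f + 2 * d g - 4 * \<delta>" if f: "f \<in> ?D" and g: "g \<in> ?D" for f g
  proof -
    define h where "h = (1/2) *\<^sub>R (f + g)"
    have h: "h \<in> ?D"
      unfolding h_def by (intro analysis_domain_scaleR analysis_domain_add f g)
    have pt: "(norm (analysis \<Psi> (f - g) x))\<^sup>2 = 2 * (norm (F x - analysis \<Psi> f x))\<^sup>2
        + 2 * (norm (F x - analysis \<Psi> g x))\<^sup>2 - 4 * (norm (F x - analysis \<Psi> h x))\<^sup>2" for x
    proof -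
      have "(F x - analysis \<Psi> f x) + (F x - analysis \<Psi> g x) = 2 * (F x - analysis \<Psi> h x)"
        by (simp add: h_def analysis_scaleR analysis_add field_simps)
      moreover have "norm ((F x - analysis \<Psi> f x) - (F x - analysis \<Psi> g x)) = norm (analysis \<Psi> (f - g) x)"
        by (simp add: analysis_diff norm_minus_commute)
      ultimately show ?thesis
        using parallelogram_conj_field[of "F x - analysis \<Psi> f x" "F x - analysis \<Psi> g x"]
        by (simp only: norm_mult power_mult_distrib norm_numeral) simp
    qed
    have "m * (norm (f - g))\<^sup>2 \<le> (LINT x|M. (norm (analysis \<Psi> (f - g) x))\<^sup>2)"
      by (rule lower[OF analysis_domain_diff[OF f g]])
    also have "\<dots> = 2 * d f + 2 * d g - 4 * d h"
      unfolding pt d_def using int[OF f] int[OF g] int[OF h] by simp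
    finally show ?thesis
      using \<delta>_le[OF h] by linarith
  qed
  have "\<exists>f\<in>?D. d f < \<delta> + inverse (real (Suc n))" for n
  proof (rule cINF_less_iff[OF _ bdd, THEN iffD1])
    show "?D \<noteq> {}"
      using analysis_domain_zero by blast
    show "(INF f\<in>?D. d f) < \<delta> + inverse (real (Suc n))"
      unfolding \<delta>_def[symmetric] by simp
  qed
  then obtain f where f: "\<And>n. f n \<in> ?D" "\<And>n. d (f n) < \<delta> + inverse (real (Suc n))"
    by metis
  have "Cauchy f"
  proof (rule CauchyI)
    fix e :: real
    assume e: "e > 0"
    \<comment> \<open>Two terms within this threshold of \<open>\<delta>\<close> keep the right side
      of \<open>dist\<close> below four times the threshold, that is, below
      \<open>m * e\<^sup>2\<close>.\<close>
    then obtain N where N: "inverse (real (Suc N)) < m * e\<^sup>2 / 4"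
      using reals_Archimedean[of "m * e\<^sup>2 / 4"] m(1) by auto
    have "norm (f k - f n) < e" if "k \<ge> N" "n \<ge> N" for k n
    proof -
      have small: "d (f i) < \<delta> + m * e\<^sup>2 / 4" if "i \<ge> N" for i
      proof -
        have "inverse (real (Suc i)) \<le> inverse (real (Suc N))"
          using that by (intro le_imp_inverse_le) auto
        then show ?thesis
          using f(2)[of i] N by linarith
      qed
      have "m * (norm (f k - f n))\<^sup>2 < m * e\<^sup>2"
        using dist[OF f(1) f(1), of k n] small[OF that(1)] small[OF that(2)] by linarith
      then show ?thesis
        using m(1) e by (simp add: power2_less_imp_less)
    qed
    then show "\<exists>N. \<forall>k\<ge>N. \<forall>n\<ge>N. norm (f k - f n) < e"
      by blast
  qed
  then obtain g where g: "f \<longlonglongrightarrow> g"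
    using Cauchy_convergent convergentD by blast
  have pointwise: "(\<lambda>n. analysis \<Psi> (f n) x) \<longlonglongrightarrow> analysis \<Psi> g x" for x
    unfolding analysis_def by (rule bounded_linear.tendsto[OF bounded_linear_ip_left g])
  have d_lim: "(\<lambda>n. d (f n)) \<longlonglongrightarrow> \<delta>"
  proof (rule tendsto_sandwich[OF _ _ tendsto_const])
    show "\<forall>\<^sub>F n in sequentially. d (f n) \<le> \<delta> + inverse (real (Suc n))"
      using f(2) by (auto intro: always_eventually less_imp_le)
    show "(\<lambda>n. \<delta> + inverse (real (Suc n))) \<longlonglongrightarrow> \<delta>"
      using tendsto_add[OF tendsto_const LIMSEQ_inverse_real_of_nat] by simp
  qed (use \<delta>_le[OF f(1)] in auto)
  \<comment> \<open>\<open>ennreal\<close> sends negative reals to 0, so the Fatou bound can be read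
    back as a real inequality only once this is known.\<close>
  have \<delta>_nonneg: "\<delta> \<ge> 0"
    unfolding \<delta>_def by (rule cINF_greatest) (use analysis_domain_zero in \<open>auto simp: d_def\<close>)
  have "(\<integral>\<^sup>+ x. ennreal ((norm (F x - analysis \<Psi> g x))\<^sup>2) \<partial>M)
      = (\<integral>\<^sup>+ x. liminf (\<lambda>n. ennreal ((norm (F x - analysis \<Psi> (f n) x))\<^sup>2)) \<partial>M)"
    by (intro nn_integral_cong lim_imp_Liminf[symmetric] tendsto_ennrealI tendsto_intros pointwise) simp
  also have "\<dots> \<le> liminf (\<lambda>n. \<integral>\<^sup>+ x. ennreal ((norm (F x - analysis \<Psi> (f n) x))\<^sup>2) \<partial>M)"
    by (rule nn_integral_liminf) measurable
  also have "\<dots> = liminf (\<lambda>n. ennreal (d (f n)))"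
    unfolding d_def by (subst nn_integral_eq_integral[OF int[OF f(1)]]) simp_all
  also have "\<dots> = ennreal \<delta>"
    by (intro lim_imp_Liminf tendsto_ennrealI d_lim) simp
  finally have fatou: "(\<integral>\<^sup>+ x. ennreal ((norm (F x - analysis \<Psi> g x))\<^sup>2) \<partial>M) \<le> ennreal \<delta>" .
  have "integrable M (\<lambda>x. (norm (F x - analysis \<Psi> g x))\<^sup>2)"
    using fatou by (intro integrableI_bounded) (auto intro: le_less_trans)
  then have R: "(\<lambda>x. F x - analysis \<Psi> g x) \<in> L2 M"
    by (simp add: L2_def)
  \<comment> \<open>The domain may be a proper subspace, so the limit has to be shown to lie in it:
    its analysis is \<open>F\<close> minus the residual, both in $L^2$.\<close>
  have gD: "g \<in> ?D"
    using L2_diff[OF F R] by (simp add: analysis_domain_def)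
  have "ennreal (d g) \<le> ennreal \<delta>"
    using fatou unfolding d_def by (subst (asm) nn_integral_eq_integral[OF int[OF gD]]) simp_all
  then have dg: "d g \<le> \<delta>"
    using \<delta>_nonneg by simp
  have "L2_inner M (\<lambda>x. F x - analysis \<Psi> g x) (analysis \<Psi> h) = 0" if h: "h \<in> ?D" for h
  proof (rule L2_orthogonal_if_minimal[OF R analysis_L2[OF h]])
    fix t
    \<comment> \<open>Moving along \<open>h\<close> stays in the domain and cannot reduce the
      squared distance below its minimum.\<close>
    have "d g \<le> d (g + scale t h)"
      using dg \<delta>_le[OF analysis_domain_add[OF gD analysis_domain_scale[OF h, of t]]] by linarith
    then show "(LINT x|M. (norm (F x - analysis \<Psi> g x))\<^sup>2)
        \<le> (LINT x|M. (norm (F x - analysis \<Psi> g x - t * analysis \<Psi> h x))\<^sup>2)"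
      by (simp add: d_def analysis_add analysis_scale diff_diff_eq)
  qed
  then show thesis
    using R gD by (intro that[of g]) (auto simp: L2_orthogonal_complement_def analysis_range_def)
qed

section \<open>Measurability of the norm of a weakly measurable map\<close>

lemma norm_le_iff_dense:
  assumes dense: "closure Q = UNIV" and "a \<ge> 0"
  shows "norm y \<le> a \<longleftrightarrow> (\<forall>q\<in>Q. norm (ip q y) \<le> a * norm q)"
proof
  assume a: "norm y \<le> a"
  show "\<forall>q\<in>Q. norm (ip q y) \<le> a * norm q"
  proof
    fix q
    have "norm (ip q y) \<le> norm q * norm y"
      by (rule cauchy_schwarz)
    also have "\<dots> \<le> a * norm q"
      using mult_left_mono[OF a norm_ge_zero[of q]] by (simp add: mult.commute)
    finally show "norm (ip q y) \<le> a * norm q" .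
  qed
next
  assume *: "\<forall>q\<in>Q. norm (ip q y) \<le> a * norm q"
  \<comment> \<open>Both sides are continuous in \<open>f\<close>, so the estimate extends from
    \<open>Q\<close> to the whole space; testing it at \<open>f = y\<close> bounds the norm.\<close>
  have "closed {f. norm (ip f y) \<le> a * norm f}"
    by (intro closed_Collect_le continuous_intros linear_continuous_on bounded_linear_ip_left)
  then have "closure Q \<subseteq> {f. norm (ip f y) \<le> a * norm f}"
    using * by (intro closure_minimal) auto
  then have "norm (ip y y) \<le> a * norm y"
    using dense by blast
  then have "norm y * norm y \<le> a * norm y"
    by (simp add: ip_self norm_mult power2_eq_square)
  then show "norm y \<le> a"
    using assms(2) by (cases "norm y = 0") auto
qed

text \<open>Weak measurability controls only the scalar functions \<open>ip q (\<Psi> x)\<close>.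
  Separability supplies a countable dense set of such \<open>q\<close>, and testing against it makes
  each sublevel set with \<open>a \<ge> 0\<close> a countable intersection of measurable
  sets.\<close>

lemma borel_measurable_norm_weakly_measurable:
  assumes separable: "separable_space (euclidean :: 'h topology)"
    and meas: "weakly_measurable M \<Psi>"
  shows "(\<lambda>x. norm (\<Psi> x)) \<in> borel_measurable M"
proof -
  obtain Q :: "'h set" where Q: "countable Q" "closure Q = UNIV"
    using separable unfolding separable_space_def by (auto simp: euclidean_closure_of)
  have [measurable]: "(\<lambda>x. ip q (\<Psi> x)) \<in> borel_measurable M" for q
    using meas by (simp add: weakly_measurable_def)
  have "{x \<in> space M. norm (\<Psi> x) \<le> a} \<in> sets M" for a
  proof (cases "a \<ge> 0")
    case True
    have "{x \<in> space M. \<forall>q\<in>Q. norm (ip q (\<Psi> x)) \<le> a * norm q} \<in> sets M"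
      by (rule sets.sets_Collect_countable_All'[OF _ Q(1)]) measurable
    then show ?thesis
      by (simp only: norm_le_iff_dense[OF Q(2) True])
  next
    case False
    then have "{x \<in> space M. norm (\<Psi> x) \<le> a} = {}"
      using norm_ge_zero order_trans by blast
    then show ?thesis
      by (metis sets.empty_sets)
  qed
  then show ?thesis
    by (simp add: borel_measurable_iff_le)
qed

text \<open>Some nontrivial combination of the \<open>n\<close> indicators is almost everywhere the
  analysis of a vector \<open>g\<close>. Its $L^2$ norm bounds \<open>norm g\<close> from above
  through the frame inequality, its largest value bounds \<open>norm g\<close> from below through
  Cauchy-Schwarz. Both \<open>n\<close> and \<open>m\<close> are fixed before \<open>E\<close>,
  \<open>\<epsilon>\<close> and \<open>K\<close>, so \<open>\<epsilon>\<close> can later be chosen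
  in terms of them.\<close>

lemma disjoint_sets_lower_bound:
  assumes frame: "lower_semi_frame M \<Psi>" and red: "redundancy M \<Psi> < \<infinity>"
  obtains n :: nat and m :: real where "m > 0"
    "\<And>E \<epsilon> K. disjoint_family_on E {..<n} \<Longrightarrow> (\<And>i. i < n \<Longrightarrow> E i \<in> sets M) \<Longrightarrow>
      (\<And>i. i < n \<Longrightarrow> emeasure M (E i) > 0) \<Longrightarrow> (\<And>i. i < n \<Longrightarrow> emeasure M (E i) \<le> ennreal \<epsilon>) \<Longrightarrow>
      \<epsilon> \<ge> 0 \<Longrightarrow> (\<And>i x. i < n \<Longrightarrow> x \<in> E i \<Longrightarrow> norm (\<Psi> x) \<le> K) \<Longrightarrow> m \<le> K\<^sup>2 * n * \<epsilon>"
proof -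
  obtain m where m: "m > 0"
    "\<And>f. ennreal (m * (norm f)\<^sup>2) \<le> (\<integral>\<^sup>+ x. ennreal ((norm (ip f (\<Psi> x)))\<^sup>2) \<partial>M)"
    using frame unfolding lower_semi_frame_def by blast
  obtain n where n: "\<And>F. \<forall>i<n. F i \<in> L2_orthogonal_complement M (analysis_range M \<Psi>)
      \<Longrightarrow> \<not> L2_independent M n F"
    using L2_dim_finite_bound[OF red[unfolded redundancy_def]] by blast
  show thesis
  proof (rule that[OF m(1)])
    fix E :: "nat \<Rightarrow> _" and \<epsilon> K :: real
    assume disj: "disjoint_family_on E {..<n}"
      and E: "\<And>i. i < n \<Longrightarrow> E i \<in> sets M"
      and pos: "\<And>i. i < n \<Longrightarrow> emeasure M (E i) > 0"
      and small: "\<And>i. i < n \<Longrightarrow> emeasure M (E i) \<le> ennreal \<epsilon>" and \<epsilon>: "\<epsilon> \<ge> 0"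
      and K: "\<And>i x. i < n \<Longrightarrow> x \<in> E i \<Longrightarrow> norm (\<Psi> x) \<le> K"
    have "\<exists>f. f \<in> analysis_domain M \<Psi> \<and>
      (\<lambda>x. indicator (E i) x - analysis \<Psi> f x) \<in> L2_orthogonal_complement M (analysis_range M \<Psi>)"
      if "i < n" for i
    proof -
      have "emeasure M (E i) < \<infinity>"
        using small[OF that] by (simp add: le_less_trans)
      then show ?thesis
        using exists_projection_onto_analysis_range[OF frame L2_indicator[OF E[OF that]]] by metis
    qed
    then obtain f where f: "\<And>i. i < n \<Longrightarrow>
      (\<lambda>x. indicator (E i) x - analysis \<Psi> (f i) x) \<in> L2_orthogonal_complement M (analysis_range M \<Psi>)"
      by metis
    \<comment> \<open>The complement contains no independent family of length \<open>n\<close>, so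
      the residuals of the indicators are dependent modulo null functions.\<close>
    obtain c i0 where AE0: "AE x in M. (\<Sum>i<n. c i * (indicator (E i) x - analysis \<Psi> (f i) x)) = 0"
      and i0: "i0 < n" "c i0 \<noteq> 0"
      using n[of "\<lambda>i x. indicator (E i) x - analysis \<Psi> (f i) x"] f unfolding L2_independent_def by blast
    \<comment> \<open>The same combination of the projected vectors: vanishing of the combined
      residuals says that its analysis is the combination of the indicators.\<close>
    define g where "g = (\<Sum>i<n. scale (c i) (f i))"
    have AE: "AE x in M. ip g (\<Psi> x) = (\<Sum>i<n. c i * indicator (E i) x)"
      using AE0
      by eventually_elim
        (simp add: g_def ip_sum_scale_left analysis_def right_diff_distrib sum_subtractf)
    have sum_E: "(\<Sum>i<n. c i * indicator (E i) x) = c j" if "j < n" "x \<in> E j" for j x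
    proof -
      have "(\<Sum>i<n. c i * indicator (E i) x) = (\<Sum>i<n. if i = j then c j else 0)"
        using disj that by (intro sum.cong) (auto simp: disjoint_family_on_def indicator_def)
      then show ?thesis
        using that by simp
    qed
    \<comment> \<open>The largest coefficient dominates all values of the combination and is itself
      attained on \<open>E j\<close>.\<close>
    obtain j where j: "j < n" "\<And>i. i < n \<Longrightarrow> norm (c i) \<le> norm (c j)"
    proof -
      let ?m = "Max ((\<lambda>i. norm (c i)) ` {..<n})"
      have "?m \<in> (\<lambda>i. norm (c i)) ` {..<n}"
        using i0 by (intro Max_in) auto
      then obtain j where "j < n" "?m = norm (c j)"
        by auto
      then show ?thesis
        by (intro that[of j]) (auto simp flip: \<open>?m = norm (c j)\<close>)
    qed
    have cj: "norm (c j) > 0"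
      using j(2)[OF i0(1)] i0(2) by (meson less_le_trans zero_less_norm_iff)
    \<comment> \<open>The identity \<open>AE\<close> holds only almost everywhere, but
      \<open>E j\<close> is not null and so contains a point where it holds.\<close>
    have "\<exists>x\<in>E j. ip g (\<Psi> x) = (\<Sum>i<n. c i * indicator (E i) x)"
    proof (rule ccontr)
      assume *: "\<not> ?thesis"
      have "AE x in M. x \<notin> E j"
        using AE by eventually_elim (use * in auto)
      then show False
        using pos[OF j(1)] AE_iff_null_sets[OF E[OF j(1)]] by (simp add: null_sets_def)
    qed
    then obtain x where x: "x \<in> E j" "ip g (\<Psi> x) = c j"
      using sum_E[OF j(1)] by metis
    have "norm (c j) \<le> norm g * norm (\<Psi> x)"
      using cauchy_schwarz[of g "\<Psi> x"] x(2) by simp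
    also have "\<dots> \<le> norm g * K"
      using K[OF j(1) x(1)] by (simp add: mult_left_mono)
    finally have "(norm (c j))\<^sup>2 \<le> (norm g * K)\<^sup>2"
      using cj by (intro power_mono) auto
    then have eval: "(norm (c j))\<^sup>2 \<le> K\<^sup>2 * (norm g)\<^sup>2"
      by (simp add: power_mult_distrib mult.commute)
    have "ennreal (m * (norm g)\<^sup>2) \<le> (\<integral>\<^sup>+ x. ennreal ((norm (ip g (\<Psi> x)))\<^sup>2) \<partial>M)"
      by (rule m(2))
    \<comment> \<open>By disjointness at most one indicator is nonzero at each point.\<close>
    also have "\<dots> \<le> (\<integral>\<^sup>+ x. (\<Sum>i<n. ennreal ((norm (c j))\<^sup>2) * indicator (E i) x) \<partial>M)"
    proof (rule nn_integral_mono_AE)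
      show "AE x in M. ennreal ((norm (ip g (\<Psi> x)))\<^sup>2) \<le> (\<Sum>i<n. ennreal ((norm (c j))\<^sup>2) * indicator (E i) x)"
        using AE
      proof eventually_elim
        fix x
        assume gx: "ip g (\<Psi> x) = (\<Sum>i<n. c i * indicator (E i) x)"
        show "ennreal ((norm (ip g (\<Psi> x)))\<^sup>2) \<le> (\<Sum>i<n. ennreal ((norm (c j))\<^sup>2) * indicator (E i) x)"
        proof (cases "\<exists>i<n. x \<in> E i")
          case True
          then obtain i where i: "i < n" "x \<in> E i"
            by blast
          have "ennreal ((norm (ip g (\<Psi> x)))\<^sup>2) \<le> ennreal ((norm (c j))\<^sup>2) * indicator (E i) x"
            using j(2)[OF i(1)] i by (simp add: gx sum_E[OF i] ennreal_leI power_mono)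
          also have "\<dots> \<le> (\<Sum>i<n. ennreal ((norm (c j))\<^sup>2) * indicator (E i) x)"
            using i(1) by (intro member_le_sum) auto
          finally show ?thesis .
        next
          case False
          then have "ip g (\<Psi> x) = 0"
            unfolding gx by (intro sum.neutral) auto
          then show ?thesis
            by simp
        qed
      qed
    qed
    also have "\<dots> = (\<Sum>i<n. ennreal ((norm (c j))\<^sup>2) * emeasure M (E i))"
      using E by (subst nn_integral_sum) (auto intro!: sum.cong simp: nn_integral_cmult_indicator)
    also have "\<dots> \<le> (\<Sum>i<n. ennreal ((norm (c j))\<^sup>2) * ennreal \<epsilon>)"
      using small by (intro sum_mono mult_left_mono) auto
    also have "\<dots> = ennreal ((norm (c j))\<^sup>2 * n * \<epsilon>)"
      using \<epsilon> by (simp add: ennreal_mult ennreal_of_nat_eq_real_of_nat mult_ac)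
    finally have "m * (norm g)\<^sup>2 \<le> (norm (c j))\<^sup>2 * n * \<epsilon>"
      using \<epsilon> by (simp add: ennreal_le_iff)
    \<comment> \<open>Multiplying by \<open>K\<^sup>2\<close> lets \<open>eval\<close> eliminate
      \<open>norm g\<close> without a division by \<open>K\<close>; the positive factor
      \<open>(norm (c j))\<^sup>2\<close> cancels at the end.\<close>
    then have "K\<^sup>2 * (m * (norm g)\<^sup>2) \<le> K\<^sup>2 * ((norm (c j))\<^sup>2 * n * \<epsilon>)"
      by (intro mult_left_mono) auto
    moreover have "m * (norm (c j))\<^sup>2 \<le> m * (K\<^sup>2 * (norm g)\<^sup>2)"
      using eval m(1) by simp
    ultimately have "(norm (c j))\<^sup>2 * m \<le> (norm (c j))\<^sup>2 * (K\<^sup>2 * n * \<epsilon>)"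
      by (simp add: mult_ac)
    then show "m \<le> K\<^sup>2 * n * \<epsilon>"
      using cj by simp
  qed
qed

text \<open>The members of \<open>P\<close> are split at a threshold \<open>\<epsilon>\<close>:
  fewer than \<open>n\<close> can be small, by the preceding estimate, and the finite measure of
  \<open>Y\<close> has room for only finitely many large ones.\<close>

lemma finite_redundancy_disjoint_bound:
  assumes "lower_semi_frame M \<Psi>" "redundancy M \<Psi> < \<infinity>"
    and Y: "Y \<in> sets M" "emeasure M Y < \<infinity>" and K: "\<And>x. x \<in> Y \<Longrightarrow> norm (\<Psi> x) \<le> K"
  obtains N :: nat where "\<And>P. finite P \<Longrightarrow> P \<subseteq> sets M \<Longrightarrow> disjoint P \<Longrightarrow>
    (\<And>A. A \<in> P \<Longrightarrow> A \<subseteq> Y \<and> emeasure M A > 0) \<Longrightarrow> card P < N"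
proof (rule disjoint_sets_lower_bound[OF assms(1,2)])
  fix n :: nat and m :: real
  assume m: "m > 0"
    and le: "\<And>E \<epsilon> K. disjoint_family_on E {..<n} \<Longrightarrow> (\<And>i. i < n \<Longrightarrow> E i \<in> sets M) \<Longrightarrow>
      (\<And>i. i < n \<Longrightarrow> emeasure M (E i) > 0) \<Longrightarrow> (\<And>i. i < n \<Longrightarrow> emeasure M (E i) \<le> ennreal \<epsilon>) \<Longrightarrow>
      \<epsilon> \<ge> 0 \<Longrightarrow> (\<And>i x. i < n \<Longrightarrow> x \<in> E i \<Longrightarrow> norm (\<Psi> x) \<le> K) \<Longrightarrow> m \<le> K\<^sup>2 * n * \<epsilon>"
  \<comment> \<open>Chosen so that \<open>K\<^sup>2 * n * \<epsilon> < m\<close>; the summand 1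
    keeps the denominator positive when \<open>K\<close> or \<open>n\<close> is 0.\<close>
  define \<epsilon> where "\<epsilon> = m / (2 * (K\<^sup>2 * n + 1))"
  have pos: "K\<^sup>2 * n + 1 > 0"
    by (simp add: add_nonneg_pos)
  have \<epsilon>: "\<epsilon> > 0"
    using m pos by (simp add: \<epsilon>_def)
  have "K\<^sup>2 * n * \<epsilon> \<le> (K\<^sup>2 * n + 1) * \<epsilon>"
    using \<epsilon> by (simp add: algebra_simps)
  also have "\<dots> = m / 2"
    using pos unfolding \<epsilon>_def by (simp add: field_simps)
  finally have less: "K\<^sup>2 * n * \<epsilon> < m"
    using m by linarith
  show thesis
  proof (rule that)
    fix P
    assume P: "finite P" "P \<subseteq> sets M" "disjoint P" "\<And>A. A \<in> P \<Longrightarrow> A \<subseteq> Y \<and> emeasure M A > 0"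
    define S where "S = {A \<in> P. emeasure M A \<le> ennreal \<epsilon>}"
    have S: "card S < n"
    proof (rule ccontr)
      assume "\<not> card S < n"
      \<comment> \<open>Exactly \<open>n\<close> small sets are selected, and enumerated, to
        contradict the choice of \<open>\<epsilon>\<close>.\<close>
      then obtain T where T: "T \<subseteq> S" "card T = n" "finite T"
        using obtain_subset_with_card_n[of n S] by (metis not_less)
      then obtain E where E: "bij_betw E {..<n} T"
        using ex_bij_betw_nat_finite[of T] by (auto simp: atLeast0LessThan)
      have ET: "E i \<in> S" if "i < n" for i
        using E T(1) that by (auto dest: bij_betwE)
      have "m \<le> K\<^sup>2 * n * \<epsilon>"
      proof (rule le[of E])
        show "disjoint_family_on E {..<n}"
          unfolding disjoint_family_on_def
        proof (intro ballI impI)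
          fix i k
          assume "i \<in> {..<n}" "k \<in> {..<n}" "i \<noteq> k"
          then have "E i \<noteq> E k" "E i \<in> P" "E k \<in> P"
            using E ET by (auto simp: bij_betw_def inj_on_def S_def)
          then show "E i \<inter> E k = {}"
            using P(3) by (auto simp: pairwise_def disjnt_def)
        qed
        show "norm (\<Psi> x) \<le> K" if "i < n" "x \<in> E i" for i x
          using ET[OF that(1)] that(2) P(4) K unfolding S_def by blast
      qed (use ET P(2,4) \<epsilon> in \<open>auto simp: S_def\<close>)
      then show False
        using less by linarith
    qed
    \<comment> \<open>Each remaining set has measure above \<open>\<epsilon>\<close>, and together
      they fit disjointly into \<open>Y\<close>.\<close>
    have "of_nat (card (P - S)) * ennreal \<epsilon> \<le> (\<Sum>A\<in>P - S. emeasure M A)"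
      by (subst sum_constant[symmetric]) (intro sum_mono, auto simp: S_def)
    also have "\<dots> = emeasure M (\<Union>A\<in>P - S. A)"
      using P by (intro sum_emeasure) (auto simp: disjoint_family_on_def pairwise_def disjnt_def)
    also have "\<dots> \<le> emeasure M Y"
      using P(4) Y(1) by (intro emeasure_mono) auto
    also have "\<dots> = ennreal (measure M Y)"
      using Y(2) by (intro emeasure_eq_ennreal_measure) auto
    finally have "card (P - S) * \<epsilon> \<le> measure M Y"
      using \<epsilon> by (simp add: ennreal_of_nat_eq_real_of_nat flip: ennreal_mult)
    then have "real (card (P - S)) \<le> measure M Y / \<epsilon>"
      using \<epsilon> by (simp add: field_simps)
    then have "card (P - S) \<le> nat \<lceil>measure M Y / \<epsilon>\<rceil>"
      by linarith
    moreover have "card P = card S + card (P - S)"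
      using card_Un_disjoint[of S "P - S"] P(1) by (simp add: S_def Un_absorb1 Un_Diff_cancel)
    ultimately show "card P < n + nat \<lceil>measure M Y / \<epsilon>\<rceil>"
      using S by linarith
  qed
qed

end

section \<open>Partitions into atoms\<close>

text \<open>A positive family of maximal cardinality consists of atoms and exhausts \<open>Y\<close> up to a null set.\<close>

lemma exists_atom_partition_if_disjoint_bound:
  assumes Y: "Y \<in> sets M"
    and bound: "\<And>P. finite P \<Longrightarrow> P \<subseteq> sets M \<Longrightarrow> disjoint P \<Longrightarrow>
      (\<And>A. A \<in> P \<Longrightarrow> A \<subseteq> Y \<and> emeasure M A > 0) \<Longrightarrow> card P < N"
  obtains Q where "countable Q" "disjoint Q" "\<Union>Q = Y" "\<And>A. A \<in> Q \<Longrightarrow> atom M A \<or> A \<in> null_sets M"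
proof -
  define good where "good P \<longleftrightarrow> finite P \<and> P \<subseteq> sets M \<and> disjoint P \<and>
    (\<forall>A\<in>P. A \<subseteq> Y \<and> emeasure M A > 0)" for P
  have "good {}"
    by (simp add: good_def)
  moreover have "\<forall>P. good P \<longrightarrow> card P < N"
    using bound by (simp add: good_def)
  ultimately obtain P where P: "good P" and max: "\<And>P'. good P' \<Longrightarrow> card P' \<le> card P"
    using ex_has_greatest_nat[of good "{}" card N] by blast
  have fin: "finite P" and sets: "P \<subseteq> sets M" and disj: "disjoint P"
    and sub: "\<And>A. A \<in> P \<Longrightarrow> A \<subseteq> Y" and pos: "\<And>A. A \<in> P \<Longrightarrow> emeasure M A > 0"
    using P by (auto simp: good_def)
  have atoms: "atom M A" if A: "A \<in> P" for A
    unfolding atom_def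
  proof (intro conjI ballI impI)
    show "A \<in> sets M" "emeasure M A > 0"
      using A sets pos by auto
    fix B
    assume B: "B \<in> sets M" and BA: "B \<subseteq> A \<and> emeasure M B < emeasure M A"
    show "emeasure M B = 0"
    proof (rule ccontr)
      assume "emeasure M B \<noteq> 0"
      then have posB: "emeasure M B > 0"
        by (simp add: zero_less_iff_neq_zero)
      \<comment> \<open>If \<open>A - B\<close> were null, subadditivity would contradict
        \<open>emeasure M B < emeasure M A\<close>.\<close>
      have "emeasure M A \<le> emeasure M B + emeasure M (A - B)"
        using emeasure_subadditive[of B M "A - B"] B BA A sets by (auto simp: Un_absorb1)
      then have posD: "emeasure M (A - B) > 0"
        using BA by (auto simp: zero_less_iff_neq_zero)
      \<comment> \<open>Replacing \<open>A\<close> by its two positive parts gives a larger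
        admissible family.\<close>
      define P' where "P' = insert B (insert (A - B) (P - {A}))"
      have ne: "B \<noteq> {}" "A - B \<noteq> {}"
        using posB posD by force+
      have other: "C \<inter> A = {}" if "C \<in> P - {A}" for C
        using disj that A by (auto simp: pairwise_def disjnt_def)
      have "good P'"
        unfolding good_def
      proof (intro conjI)
        show "disjoint P'"
          using disj other BA unfolding P'_def pairwise_insert
          by (auto simp: disjnt_def pairwise_def)
              show "\<forall>C\<in>P'. C \<subseteq> Y \<and> emeasure M C > 0"
          using sub sub[OF A] BA pos posB posD unfolding P'_def by blast
      qed (use fin sets A B in \<open>auto simp: P'_def\<close>)
      moreover have "card P' = Suc (card P)"
      proof -
        have "B \<notin> P - {A}" "A - B \<notin> P - {A}" "B \<noteq> A - B"
          using other ne BA by blast+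
        then show ?thesis
          using fin A card_Suc_Diff1[OF fin A] by (simp add: P'_def)
      qed
      ultimately show False
        using max by fastforce
    qed
  qed
  let ?R = "Y - \<Union>P"
  have R: "?R \<in> sets M"
    using Y fin sets by auto
  have "?R \<in> null_sets M"
  \<comment> \<open>A remainder of positive measure could be added to \<open>P\<close>, against
    maximality.\<close>
  proof (rule ccontr)
    assume "?R \<notin> null_sets M"
    then have posR: "emeasure M ?R > 0"
      using R by (auto simp: null_sets_def zero_less_iff_neq_zero)
    then have "?R \<noteq> {}"
      by force
    then have "?R \<notin> P"
      by blast
    moreover have "good (insert ?R P)"
      using fin sets disj sub pos posR R by (auto simp: good_def pairwise_insert disjnt_def)
    ultimately show False
      using max[of "insert ?R P"] fin by simp
  qed
  then show thesis
    using fin disj sub atoms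
    by (intro that[of "insert ?R P"]) (auto simp: pairwise_insert disjnt_def countable_finite)
qed

text \<open>Passes from a countable set of pieces to the sequence demanded by \<open>atomic\<close>;
  indices left over are filled with the empty set, which is null.\<close>

lemma atomic_if_countable_partition:
  assumes Q: "countable Q" "disjoint Q" "\<Union>Q = space M"
    and atoms: "\<And>A. A \<in> Q \<Longrightarrow> atom M A \<or> A \<in> null_sets M"
  shows "atomic M"
proof -
  \<comment> \<open>Outside the range of \<open>to_nat_on Q\<close>, \<open>from_nat_into Q\<close>
    would return a default member again and destroy disjointness; the guard excludes this.\<close>
  define A where "A n = (if n \<in> to_nat_on Q ` Q then from_nat_into Q n else {})" for n
  have A_to_nat: "A (to_nat_on Q B) = B" if "B \<in> Q" for B
    using Q(1) that by (simp add: A_def)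
  have A_cases: "A n = {} \<or> A n \<in> Q \<and> to_nat_on Q (A n) = n" for n
    using Q(1) by (auto simp: A_def)
  have "disjoint_family A"
    unfolding disjoint_family_on_def
  proof (intro ballI impI)
    fix i j :: nat
    assume "i \<noteq> j"
    then show "A i \<inter> A j = {}"
      using A_cases[of i] A_cases[of j] Q(2) unfolding pairwise_def disjnt_def
      by (metis inf_bot_left inf_bot_right)
  qed
  moreover have "(\<Union>n. A n) = space M"
    unfolding Q(3)[symmetric]
  proof
    show "(\<Union>n. A n) \<subseteq> \<Union>Q"
      using A_cases by (metis UN_least Union_upper empty_subsetI)
    show "\<Union>Q \<subseteq> (\<Union>n. A n)"
      using A_to_nat by (metis UN_upper UNIV_I Union_least)
  qed
  moreover have "atom M (A n) \<or> A n \<in> null_sets M" for n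
    using A_cases[of n] atoms by auto
  ultimately show ?thesis
    unfolding atomic_def by blast
qed

section \<open>Exhaustion by pieces of finite measure on which \<open>\<Psi>\<close> is
  bounded\<close>

theorem theorem9:
  fixes scale :: "'k::conj_field \<Rightarrow> 'h::banach \<Rightarrow> 'h"
    and ip :: "'h \<Rightarrow> 'h \<Rightarrow> 'k"
    and M :: "'x measure"
    and \<Psi> :: "'x \<Rightarrow> 'h"
  assumes hilbert: "hilbert_space scale ip"
    and separable: "separable_space (euclidean :: 'h topology)"
    and sigma_finite: "sigma_finite_measure M"
    and non_trivial: "emeasure M (space M) \<noteq> 0"
    and frame: "hilbert_space.continuous_frame ip M \<Psi> \<or> hilbert_space.lower_semi_frame ip M \<Psi>"
    and finite_redundancy: "hilbert_space.redundancy ip M \<Psi> < \<infinity>"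
  shows "atomic M"
proof -
  interpret hilbert_space scale ip
    by (rule hilbert)
  interpret sigma_finite_measure M
    by (rule sigma_finite)
  have lsf: "lower_semi_frame M \<Psi>"
    using frame by (auto simp: continuous_frame_def)
  have [measurable]: "(\<lambda>x. norm (\<Psi> x)) \<in> borel_measurable M"
    using lsf by (intro borel_measurable_norm_weakly_measurable[OF separable]) (simp add: lower_semi_frame_def)
  obtain X :: "nat \<Rightarrow> 'x set" where X: "range X \<subseteq> sets M" "(\<Union>i. X i) = space M"
    "\<And>i. emeasure M (X i) \<noteq> \<infinity>" "incseq X"
    using sigma_finite_incseq by blast
  \<comment> \<open>Finite measure and a uniform bound on \<open>\<Psi>\<close> are what the
    counting bound requires; \<open>disjointed\<close> then makes the pieces disjoint.\<close>
  define Z where "Z n = X n \<inter> {x \<in> space M. norm (\<Psi> x) \<le> real n}" for n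
  define Y where "Y = disjointed Z"
  have Z: "range Z \<subseteq> sets M"
    using X(1) by (auto simp: Z_def)
  have UN_Z: "(\<Union>n. Z n) = space M"
  proof
    show "space M \<subseteq> (\<Union>n. Z n)"
    proof
      fix x
      assume x: "x \<in> space M"
      then obtain i where i: "x \<in> X i"
        using X(2) by blast
      obtain k where k: "norm (\<Psi> x) \<le> real k"
        using real_arch_simple by blast
      \<comment> \<open>Since \<open>X\<close> is increasing, one index can serve both the measure
        and the norm condition.\<close>
      have "x \<in> X (max i k)"
        using i incseqD[OF X(4), of i "max i k"] by auto
      then have "x \<in> Z (max i k)"
        using x k by (simp add: Z_def)
      then show "x \<in> (\<Union>n. Z n)"
        by blast
    qed
  qed (auto simp: Z_def)
  have Y_sets: "Y n \<in> sets M" for n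
    using sets.range_disjointed_sets[OF Z] by (auto simp: Y_def)
  have Y_sub: "Y n \<subseteq> Z n" for n
    by (simp add: Y_def disjointed_subset)
  have Y_fin: "emeasure M (Y n) < \<infinity>" for n
  proof -
    have "emeasure M (Y n) \<le> emeasure M (X n)"
      using X(1) Y_sub by (intro emeasure_mono) (auto simp: Z_def)
    then show ?thesis
      using X(3)[of n] by (simp add: le_less_trans top.not_eq_extremum)
  qed
  have Y_bound: "norm (\<Psi> x) \<le> real n" if "x \<in> Y n" for n x
    using Y_sub that by (auto simp: Z_def)
  have "\<exists>Q. countable Q \<and> disjoint Q \<and> \<Union>Q = Y n \<and> (\<forall>A\<in>Q. atom M A \<or> A \<in> null_sets M)" for n
  proof (rule finite_redundancy_disjoint_bound[OF lsf finite_redundancy Y_sets Y_fin Y_bound])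
    fix N
    assume bound: "\<And>P. finite P \<Longrightarrow> P \<subseteq> sets M \<Longrightarrow> disjoint P \<Longrightarrow>
      (\<And>A. A \<in> P \<Longrightarrow> A \<subseteq> Y n \<and> emeasure M A > 0) \<Longrightarrow> card P < N"
    show ?thesis
      by (rule exists_atom_partition_if_disjoint_bound[OF Y_sets bound]) auto
  qed
  then obtain Q where Q: "\<And>n. countable (Q n)" "\<And>n. disjoint (Q n)" "\<And>n. \<Union>(Q n) = Y n"
    "\<And>n A. A \<in> Q n \<Longrightarrow> atom M A \<or> A \<in> null_sets M"
    by metis
  show ?thesis
  proof (rule atomic_if_countable_partition)
    show "countable (\<Union>n. Q n)"
      using Q(1) by blast
    show "\<Union>(\<Union>n. Q n) = space M"
    proof -
      have "\<Union>(\<Union>n. Q n) = (\<Union>n. \<Union>(Q n))"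
        by auto
      then show ?thesis
        using UN_Z UN_disjointed_eq[of Z] by (simp only: Q(3) Y_def)
    qed
    have Y_disj: "Y i \<inter> Y j = {}" if "i \<noteq> j" for i j
      using disjoint_family_disjointed[of Z] that by (auto simp: Y_def disjoint_family_on_def)
    show "disjoint (\<Union>n. Q n)"
      unfolding pairwise_def disjnt_def
    proof (intro ballI impI)
      fix A B
      assume "A \<in> (\<Union>n. Q n)" "B \<in> (\<Union>n. Q n)" "A \<noteq> B"
      then obtain i j where ij: "A \<in> Q i" "B \<in> Q j"
        by blast
      show "A \<inter> B = {}"
      proof (cases "i = j")
        case True
        then show ?thesis
          using Q(2)[of i] ij \<open>A \<noteq> B\<close> by (auto simp: pairwise_def disjnt_def)
      next
        case False
        have "A \<subseteq> Y i" "B \<subseteq> Y j"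
          using ij Q(3) by blast+
        then show ?thesis
          using Y_disj[OF False] by blast
      qed
    qed
    show "atom M A \<or> A \<in> null_sets M" if "A \<in> (\<Union>n. Q n)" for A
      using that Q(4) by blast
  qed
qed

end
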